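(* Let $L \ge 3$ be a prime number. For every integer $N \ge 2$, the period $T^{F,L}_N$ of the F-type Grover walk with $L$ states on the cycle graph $C_N$ satisfies $$T^{F,L}_N = \begin{cases} 4, & N = L, \\ \infty, & N \neq L. \end{cases}$$
   Context: Let $L \ge 3$ be odd, $m = (L-1)/2$, and $N \ge 2$. The cycle graph $C_N$ has vertex set $\{0,1,\dots,N-1\}$, with vertices identified modulo $N$. Let $\mathcal{H}_P$ be the complex Hilbert space with orthonormal basis $\{|k\rangle : k \in \{0,\dots,N-1\}\}$ (labels read modulo $N$), and let $\mathcal{H}_C$ be the complex Hilbert space with ordered orthonormal basis $(|\leftarrow m\rangle, \dots, |\leftarrow 1\rangle, |\cdot\rangle, |1\rightarrow\rangle, \dots, |m\rightarrow\rangle)$. Put $\mathcal{H} = \mathcal{H}_P \otimes \mathcal{H}_C$. The shift operator $S$ on $\mathcal{H}$ is the linear operator with $S(|k\rangle\otimes|\leftarrow j\rangle) = |k-j\rangle\otimes|\leftarrow j\rangle$ and $S(|k\rangle\otimes|j\rightarrow\rangle) = |k+j\rangle\otimes|j\rightarrow\rangle$ for $j=1,\dots,m$, and $S(|k\rangle\otimes|\cdot\rangle) = |k\rangle\otimes|\cdot\rangle$, where positions are read modulo $N$. The F-type local coin operator is the operator on $\mathcal{H}_C$ whose matrix $A^{F,L}$ in the ordered basis above is the $L\times L$ matrix with every anti-diagonal entry (position $(i, L+1-i)$) equal to $-(2m-1)/L$ and every other entry equal to $2/L$. The coin operator is $C = \sum_{k=0}^{N-1} |k\rangle\langle k| \otimes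 A^{F,L}$. The F-type Grover walk with $L$ states on $C_N$ is the quantum walk with time-evolution operator $U^{F,L}_N = SC$. Its period is $T^{F,L}_N = \inf\{ n \ge 1 : (U^{F,L}_N)^n = I\}$, defined to be $\infty$ if this set is empty. *)

theory Defs
  imports
    Complex_Main
    "HOL-Library.Extended_Nat"
    "HOL-Computational_Algebra.Primes"
    "Jordan_Normal_Form.Matrix"
begin

text \<open>
  Operators on the finite-dimensional spaces are represented by complex matrices.
  The position space has dimension \<open>N\<close>, the coin space dimension \<open>L\<close>, and the basis
  vector \<open>e\<^sub>k \<otimes> e\<^sub>i\<close> of the tensor product has index \<open>k * L + i\<close>.  With
  \<open>m = (L - 1) div 2\<close>, the ordered coin basis
  \<open>\<leftarrow>m, \<dots>, \<leftarrow>1, \<cdot>, 1\<rightarrow>, \<dots>, m\<rightarrow>\<close> is indexed by \<open>0, \<dots>, 2 * m\<close>.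
\<close>

definition tensor_vec :: "complex vec \<Rightarrow> complex vec \<Rightarrow> complex vec"
  where "tensor_vec v w = vec (dim_vec v * dim_vec w)
    (\<lambda>a. v $ (a div dim_vec w) * w $ (a mod dim_vec w))"

definition tensor_mat :: "complex mat \<Rightarrow> complex mat \<Rightarrow> complex mat"
  where "tensor_mat A B = mat (dim_row A * dim_row B) (dim_col A * dim_col B)
    (\<lambda>(a, b). A $$ (a div dim_row B, b div dim_col B) * B $$ (a mod dim_row B, b mod dim_col B))"

definition half :: "nat \<Rightarrow> nat"
  where "half L = (L - 1) div 2"

definition ket_pos :: "nat \<Rightarrow> int \<Rightarrow> complex vec"
  where "ket_pos N k = unit_vec N (nat (k mod int N))"

definition ket_left :: "nat \<Rightarrow> nat \<Rightarrow> complex vec"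
  where "ket_left L j = unit_vec L (half L - j)"

definition ket_stay :: "nat \<Rightarrow> complex vec"
  where "ket_stay L = unit_vec L (half L)"

definition ket_right :: "nat \<Rightarrow> nat \<Rightarrow> complex vec"
  where "ket_right L j = unit_vec L (half L + j)"

text \<open>
  The coin state with index \<open>i\<close> moves the walker by \<open>i - m\<close>.  The lemmas
  \<open>shift_left\<close>, \<open>shift_stay\<close> and \<open>shift_right\<close> below give the action on the basis.
\<close>

definition shift_op :: "nat \<Rightarrow> nat \<Rightarrow> complex mat"
  where "shift_op L N = mat (N * L) (N * L)
    (\<lambda>(a, b). if a mod L = b mod L \<and>
        int (a div L) = (int (b div L) + (int (b mod L) - int (half L))) mod int N
      then 1 else 0)"

definition local_coin_F :: "nat \<Rightarrow> complex mat"
  where "local_coin_F L = mat L L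
    (\<lambda>(i, j). if i + j = L - 1 then - (2 * of_nat (half L) - 1) / of_nat L else 2 / of_nat L)"

definition proj_pos :: "nat \<Rightarrow> nat \<Rightarrow> complex mat"
  where "proj_pos N k = mat N N (\<lambda>(i, j). unit_vec N k $ i * cnj (unit_vec N k $ j))"

definition coin_op_F :: "nat \<Rightarrow> nat \<Rightarrow> complex mat"
  where "coin_op_F L N = finsum (module_mat TYPE(complex) (N * L) (N * L))
    (\<lambda>k. tensor_mat (proj_pos N k) (local_coin_F L)) {0..<N}"

definition walk_F :: "nat \<Rightarrow> nat \<Rightarrow> complex mat"
  where "walk_F L N = shift_op L N * coin_op_F L N"

text \<open>The infimum of the empty set in \<^typ>\<open>enat\<close> is \<open>\<infinity>\<close>.\<close>

definition period_F :: "nat \<Rightarrow> nat \<Rightarrow> enat"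
  where "period_F L N = Inf (enat ` {n. n \<ge> 1 \<and> walk_F L N ^\<^sub>m n = 1\<^sub>m (N * L)})"

lemma tensor_unit_vec:
  assumes "k < N" "i < L"
  shows "tensor_vec (unit_vec N k) (unit_vec L i) = unit_vec (N * L) (k * L + i)"
proof (rule eq_vecI)
  fix a assume "a < dim_vec (unit_vec (N * L) (k * L + i) :: complex vec)"
  hence a: "a < N * L" by simp
  hence d: "a div L < N" by (simp add: less_mult_imp_div_less)
  have L: "a mod L < L" using assms by simp
  have idx: "k * L + i < N * L"
  proof -
    have "k * L + i < Suc k * L" using assms by simp
    also have "\<dots> \<le> N * L" using assms by (intro mult_right_mono) auto
    finally show ?thesis .
  qed
  have eq: "a = k * L + i \<longleftrightarrow> a div L = k \<and> a mod L = i"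
    using assms by (metis add.commute add.right_neutral div_less div_mult_self1
        div_mult_mod_eq less_zeroE mod_less mod_mult_self1 neq0_conv)
  show "tensor_vec (unit_vec N k) (unit_vec L i) $ a = unit_vec (N * L) (k * L + i) $ a"
    using a d L idx eq assms by (auto simp: tensor_vec_def)
qed (simp add: tensor_vec_def)

lemma shift_op_basis:
  assumes k: "k < N" and i: "i < L"
  shows "shift_op L N *\<^sub>v tensor_vec (unit_vec N k) (unit_vec L i)
    = tensor_vec (ket_pos N (int k + (int i - int (half L)))) (unit_vec L i)"
proof -
  let ?z = "(int k + (int i - int (half L))) mod int N"
  have z: "0 \<le> ?z" "?z < int N" using k by auto
  hence zN: "nat ?z < N" by linarith
  have idx: "k * L + i < N * L"
  proof -
    have "k * L + i < Suc k * L" using i by simp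
    also have "\<dots> \<le> N * L" using k by (intro mult_right_mono) auto
    finally show ?thesis .
  qed
  have idx': "nat ?z * L + i < N * L"
  proof -
    have "nat ?z * L + i < Suc (nat ?z) * L" using i by simp
    also have "\<dots> \<le> N * L" using zN by (intro mult_right_mono) auto
    finally show ?thesis .
  qed
  have "shift_op L N *\<^sub>v unit_vec (N * L) (k * L + i) = unit_vec (N * L) (nat ?z * L + i)"
  proof (rule eq_vecI)
    fix a assume "a < dim_vec (unit_vec (N * L) (nat ?z * L + i) :: complex vec)"
    hence a: "a < N * L" by simp
    have "(a mod L = i \<and> int (a div L) = ?z) \<longleftrightarrow> a = nat ?z * L + i"
    proof
      assume *: "a mod L = i \<and> int (a div L) = ?z"
      hence "a div L = nat ?z" by linarith
      thus "a = nat ?z * L + i" using * by (metis div_mult_mod_eq)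
    next
      assume "a = nat ?z * L + i"
      thus "a mod L = i \<and> int (a div L) = ?z" using i z by simp
    qed
    moreover have "(k * L + i) div L = k" "(k * L + i) mod L = i" using i by simp_all
    ultimately show "(shift_op L N *\<^sub>v unit_vec (N * L) (k * L + i)) $ a
        = unit_vec (N * L) (nat ?z * L + i) $ a"
      using a idx idx' by (simp add: shift_op_def)
  qed (simp add: shift_op_def)
  thus ?thesis
    using k i zN by (simp add: tensor_unit_vec ket_pos_def)
qed

lemma shift_op_ket:
  assumes "N > 0" "i < L"
  shows "shift_op L N *\<^sub>v tensor_vec (ket_pos N k) (unit_vec L i)
    = tensor_vec (ket_pos N (k + (int i - int (half L)))) (unit_vec L i)"
proof -
  have "nat (k mod int N) < N" using assms
    by (simp add: nat_less_iff)
  from shift_op_basis[OF this assms(2)] show ?thesis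
    using assms by (simp add: ket_pos_def mod_add_left_eq)
qed

lemma shift_left:
  assumes "N > 0" "odd L" "1 \<le> j" "j \<le> half L"
  shows "shift_op L N *\<^sub>v tensor_vec (ket_pos N k) (ket_left L j)
    = tensor_vec (ket_pos N (k - int j)) (ket_left L j)"
proof -
  have "half L - j < L" using assms unfolding half_def by presburger
  from shift_op_ket[OF assms(1) this] show ?thesis
    using assms by (simp add: ket_left_def of_nat_diff)
qed

lemma shift_stay:
  assumes "N > 0" "odd L"
  shows "shift_op L N *\<^sub>v tensor_vec (ket_pos N k) (ket_stay L)
    = tensor_vec (ket_pos N k) (ket_stay L)"
proof -
  have "half L < L" using assms unfolding half_def by presburger
  from shift_op_ket[OF assms(1) this] show ?thesis by (simp add: ket_stay_def)
qed

lemma shift_right: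
  assumes "N > 0" "odd L" "1 \<le> j" "j \<le> half L"
  shows "shift_op L N *\<^sub>v tensor_vec (ket_pos N k) (ket_right L j)
    = tensor_vec (ket_pos N (k + int j)) (ket_right L j)"
proof -
  have "half L + j < L" using assms unfolding half_def by presburger
  from shift_op_ket[OF assms(1) this] show ?thesis by (simp add: ket_right_def)
qed

end

theory Submission
  imports
    Defs
    "Jordan_Normal_Form.Schur_Decomposition"
begin

text \<open>
  A Fourier transform in the position turns the walk into the \<open>L \<times> L\<close> matrices \<open>V\<^sub>z\<close>, one for
  each \<open>z\<close> with \<open>z ^ N = 1\<close>, where \<open>V\<^sub>z\<close> is the coin followed by the diagonal phases
  \<open>z powi (i - m)\<close>.  If \<open>N = L\<close>, then \<open>V\<^sub>1\<close> is an involution, and for \<open>z \<noteq> 1\<close> the square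
  of \<open>V\<^sub>z\<close> is \<open>1 - 2 * (P + Q)\<close> with orthogonal projections \<open>P\<close>, \<open>Q\<close> of rank one onto
  orthogonal lines, so that \<open>V\<^sub>z\<close> has order 4.

  If the walk has finite order, so has every \<open>V\<^sub>z\<close>, and its trace is a sum of roots of unity.  The
  trace is \<open>(2 / L) * (\<Sum>i<L. z powi (i - m)) - 1\<close>; multiplication by \<open>z ^ m * (1 - z)\<close> shows that
  \<open>2 * (1 - z ^ L) / L\<close> is an algebraic integer.  The \<open>L\<close>-th powers of the \<open>N\<close>-th roots of unity
  are the \<open>M\<close>-th roots of unity, \<open>M = N / gcd N L\<close>, so the product over those different from \<open>1\<close>
  shows that \<open>2 ^ (M - 1) * M / L ^ (M - 1)\<close> is an integer.  As \<open>L\<close> is odd and \<open>M < L ^ (M - 1)\<close>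
  for \<open>M \<ge> 2\<close>, this forces \<open>M = 1\<close>, that is \<open>N dvd L\<close>, and \<open>N = L\<close> because \<open>L\<close> is prime.
\<close>

subsection \<open>Integral combinations of roots of unity\<close>

text \<open>Differences already generate an additive group, and products of \<open>K\<close>-th
  roots of unity are again such roots, so this is the ring they generate. For \<open>K = 0\<close>
  every complex number qualifies, hence the assumption \<open>K > 0\<close> wherever integrality is
  derived.\<close>

inductive_set cyclotomic_integers :: "nat \<Rightarrow> complex set" for K where
  root: "w ^ K = 1 \<Longrightarrow> w \<in> cyclotomic_integers K"
| diff: "x \<in> cyclotomic_integers K \<Longrightarrow> y \<in> cyclotomic_integers K \<Longrightarrow> x - y \<in> cyclotomic_integers K"

lemma cyclotomic_integers_0: "0 \<in> cyclotomic_integers K"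
  using cyclotomic_integers.diff[OF cyclotomic_integers.root cyclotomic_integers.root, of 1 K 1] by simp

lemma cyclotomic_integers_mono:
  assumes "x \<in> cyclotomic_integers n" "n dvd K"
  shows "x \<in> cyclotomic_integers K"
  using assms(1)
proof induction
  case (root w)
  thus ?case using assms(2) by (intro cyclotomic_integers.root) (auto simp: power_mult dvd_def)
qed (rule cyclotomic_integers.diff)

lemma cyclotomic_integers_add:
  assumes "x \<in> cyclotomic_integers K" "y \<in> cyclotomic_integers K"
  shows "x + y \<in> cyclotomic_integers K"
  using cyclotomic_integers.diff[OF assms(1) cyclotomic_integers.diff[OF cyclotomic_integers_0 assms(2)]]
  by simp

lemma cyclotomic_integers_mult:
  assumes "x \<in> cyclotomic_integers K" "y \<in> cyclotomic_integers K"
  shows "x * y \<in> cyclotomic_integers K"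
  using assms
proof (induction x)
  case (root w)
  from root(2,1) show ?case
  proof (induction y)
    case (root v)
    thus ?case by (intro cyclotomic_integers.root) (simp add: power_mult_distrib)
  next
    case (diff x y)
    thus ?case by (simp add: right_diff_distrib cyclotomic_integers.diff)
  qed
next
  case (diff x y)
  thus ?case by (simp add: left_diff_distrib cyclotomic_integers.diff)
qed

lemma cyclotomic_integers_prod:
  "(\<And>i. i \<in> S \<Longrightarrow> f i \<in> cyclotomic_integers K) \<Longrightarrow> prod f S \<in> cyclotomic_integers K"
  by (induction S rule: infinite_finite_induct)
    (auto intro: cyclotomic_integers_mult cyclotomic_integers.root)

lemma cyclotomic_integers_sum_list:
  "(\<And>x. x \<in> set xs \<Longrightarrow> x \<in> cyclotomic_integers K) \<Longrightarrow> sum_list xs \<in> cyclotomic_integers K"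
  by (induction xs) (auto intro: cyclotomic_integers_add cyclotomic_integers_0)

text \<open>The matrix \<open>M\<close> has the eigenvector \<open>e\<close> with eigenvalue \<open>x\<close>, so \<open>x\<close> is a root of its characteristic
  polynomial.\<close>

lemma cyclotomic_integers_matrix:
  assumes "x \<in> cyclotomic_integers K" "K > 0"
  defines "e \<equiv> \<lambda>k. cis (2 * pi * real k / real K)"
  shows "\<exists>M :: nat \<Rightarrow> nat \<Rightarrow> int. \<forall>j<K. x * e j = (\<Sum>l<K. of_int (M j l) * e l)"
  using assms(1)
proof induction
  case (root w)
  note bij = bij_betw_roots_unity[OF \<open>K > 0\<close>, folded e_def]
  \<comment> \<open>Multiplication by a \<open>K\<close>-th root of unity maps the
    \<open>e j\<close> among themselves, so in this case the matrix has a single 1 in each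
    row.\<close>
  have "\<exists>l<K. w * e j = e l" if "j < K" for j
  proof -
    have "e j ^ K = 1" using bij that unfolding bij_betw_def by auto
    hence "w * e j \<in> e ` {..<K}" using bij root unfolding bij_betw_def by (auto simp: power_mult_distrib)
    thus ?thesis by auto
  qed
  then obtain l where l: "\<And>j. j < K \<Longrightarrow> l j < K \<and> w * e j = e (l j)" by metis
  show ?case
  proof (intro exI allI impI)
    fix j assume "j < K"
    have "(\<Sum>i<K. of_int (of_bool (i = l j)) * e i) = (\<Sum>i<K. if i = l j then e i else 0)"
      by (intro sum.cong) auto
    thus "w * e j = (\<Sum>i<K. of_int (of_bool (i = l j)) * e i)"
      using l[OF \<open>j < K\<close>] by simp
  qed
next
  case (diff x y)
  then obtain M M' :: "nat \<Rightarrow> nat \<Rightarrow> int" where "\<And>j. j < K \<Longrightarrow> x * e j = (\<Sum>l<K. of_int (M j l) * e l)"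
    "\<And>j. j < K \<Longrightarrow> y * e j = (\<Sum>l<K. of_int (M' j l) * e l)" by blast
  thus ?case
    by (intro exI[of _ "\<lambda>j l. M j l - M' j l"]) (simp add: left_diff_distrib sum_subtractf)
qed

text \<open>The characteristic polynomial of an integer matrix is monic with integer coefficients,
  so eigenvalues of such a matrix are algebraic integers.\<close>

lemma cyclotomic_integers_algebraic_int:
  assumes "x \<in> cyclotomic_integers K" "K > 0"
  shows "algebraic_int x"
proof -
  define e where "e k = cis (2 * pi * real k / real K)" for k
  obtain M :: "nat \<Rightarrow> nat \<Rightarrow> int" where M: "\<And>j. j < K \<Longrightarrow> x * e j = (\<Sum>l<K. of_int (M j l) * e l)"
    using cyclotomic_integers_matrix[OF assms] unfolding e_def by blast
  define A where "A = mat K K (\<lambda>(j, l). M j l)"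
  define B :: "complex mat" where "B = map_mat of_int A"
  have A: "A \<in> carrier_mat K K" and B: "B \<in> carrier_mat K K" by (auto simp: A_def B_def)
  have "eigenvector B (vec K e) x"
    unfolding eigenvector_def
  proof (intro conjI)
    \<comment> \<open>The entry \<open>e 0 = 1\<close> is nonzero.\<close>
    show "vec K e \<noteq> 0\<^sub>v (dim_row B)"
    proof
      assume "vec K e = 0\<^sub>v (dim_row B)"
      hence "vec K e $ 0 = 0\<^sub>v K $ 0" using B by simp
      thus False using \<open>K > 0\<close> by (simp add: e_def)
    qed
    show "B *\<^sub>v vec K e = x \<cdot>\<^sub>v vec K e"
      using M by (intro eq_vecI) (auto simp: A_def B_def scalar_prod_def atLeast0LessThan)
  qed (use B in auto)
  hence "poly (char_poly B) x = 0"
    using eigenvalue_root_char_poly[OF B] unfolding eigenvalue_def by blast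
  moreover have "char_poly B = map_poly of_int (char_poly A)"
    unfolding B_def by (rule of_int_hom.char_poly_hom[OF A])
  moreover have "lead_coeff (char_poly A) = 1"
    using degree_monic_char_poly[OF A] by simp
  ultimately show ?thesis unfolding algebraic_int_altdef_ipoly by auto
qed

section \<open>A product over the nontrivial roots of unity\<close>

text \<open>The nontrivial roots are the zeros of \<open>1 + X + ... + X ^ (M - 1)\<close>, which
  takes the value \<open>M\<close> at 1.\<close>

lemma prod_nontrivial_roots_of_unity:
  assumes "M > 0"
  shows "(\<Prod>w\<in>{w::complex. w ^ M = 1} - {1}. 1 - w) = of_nat M"
proof -
  define W where "W = {w::complex. w ^ M = 1} - {1}"
  have fin: "finite {w::complex. w ^ M = 1}"
    using finite_roots_unity[of M, where 'a = complex] assms by simp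
  hence cW: "finite W" "card W = M - 1"
    using card_roots_unity_eq[OF assms] by (simp_all add: W_def)
  define p :: "complex poly" where "p = (\<Prod>w\<in>W. [:- w, 1:])"
  define q :: "complex poly" where "q = (\<Sum>i<M. monom 1 i)"
  have "lead_coeff p = 1" unfolding p_def lead_coeff_prod by simp
  moreover have "degree p = M - 1"
    using cW by (simp add: p_def degree_prod_eq_sum_degree)
  ultimately have dp: "degree p = M - 1" "coeff p (M - 1) = 1" by simp_all
  \<comment> \<open>Both have degree at most \<open>M - 1\<close> and the same coefficient there, so
    \<open>M - 1\<close> common values suffice.\<close>
  have "p = q"
  proof (rule poly_eqI_degree_lead_coeff)
    show "coeff p (M - 1) = coeff q (M - 1)"
      using dp assms by (simp add: q_def coeff_sum)
    show "card W \<ge> M - 1" "degree p \<le> M - 1" using cW dp by simp_all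
    show "degree q \<le> M - 1" unfolding q_def
      by (intro degree_sum_le) (auto intro: order.trans[OF degree_monom_le])
    fix z assume z: "z \<in> W"
    hence "poly q z = 0"
      by (simp add: q_def poly_sum poly_monom W_def geometric_sum)
    moreover have "poly p z = 0" using z cW by (auto simp: p_def poly_prod)
    ultimately show "poly p z = poly q z" by simp
  qed
  moreover have "poly p 1 = (\<Prod>w\<in>W. 1 - w)" by (simp add: p_def poly_prod)
  moreover have "poly q 1 = of_nat M" by (simp add: q_def poly_sum poly_monom)
  ultimately show ?thesis by (simp add: W_def)
qed

text \<open>A single \<open>K\<close> for all \<open>w\<close> puts the product of the quotients
  into one ring of algebraic integers. The product is rational, hence an integer, which would force
  a power of \<open>L\<close> to divide the smaller number \<open>M\<close>.\<close>

lemma not_all_cyclotomic_integers: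
  fixes L M K :: nat
  assumes "odd L" "L \<ge> 3" "M \<ge> 2" "K > 0"
    and int: "\<And>w. w ^ M = 1 \<Longrightarrow> 2 * (1 - w) / of_nat L \<in> cyclotomic_integers K"
  shows False
proof -
  define W where "W = {w::complex. w ^ M = 1} - {1}"
  have fin: "finite {w::complex. w ^ M = 1}"
    using finite_roots_unity[of M, where 'a = complex] assms by simp
  hence cW: "card W = M - 1"
    using card_roots_unity_eq[of M] assms by (simp add: W_def)
  have eq: "(\<Prod>w\<in>W. 2 * (1 - w) / of_nat L) = (2 ^ (M - 1) * of_nat M / of_nat L ^ (M - 1) :: complex)"
    using prod_nontrivial_roots_of_unity[of M] cW assms(3)
    unfolding prod_dividef prod.distrib by (simp add: W_def)
  have "(\<Prod>w\<in>W. 2 * (1 - w) / of_nat L) \<in> cyclotomic_integers K"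
    using int by (intro cyclotomic_integers_prod) (auto simp: W_def)
  hence "algebraic_int (\<Prod>w\<in>W. 2 * (1 - w) / of_nat L :: complex)"
    using \<open>K > 0\<close> by (rule cyclotomic_integers_algebraic_int)
  hence "(\<Prod>w\<in>W. 2 * (1 - w) / of_nat L :: complex) \<in> \<int>"
    unfolding eq by (rule rational_algebraic_int_is_int) auto
  then obtain k :: int where "2 ^ (M - 1) * of_nat M / of_nat L ^ (M - 1) = (of_int k :: complex)"
    unfolding eq by (elim Ints_cases)
  hence "of_int (2 ^ (M - 1) * int M) = (of_int (k * int L ^ (M - 1)) :: complex)"
    using assms(2) by (simp add: field_simps)
  hence "2 ^ (M - 1) * int M = k * int L ^ (M - 1)" by (simp only: of_int_eq_iff)
  hence "int L ^ (M - 1) dvd 2 ^ (M - 1) * int M" by simp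
  moreover have "coprime (int L ^ (M - 1)) (2 ^ (M - 1))"
    using \<open>odd L\<close> by simp
  ultimately have "int (L ^ (M - 1)) dvd int M"
    by (simp add: coprime_dvd_mult_right_iff)
  hence "L ^ (M - 1) dvd M" by (simp only: int_dvd_int_iff)
  hence "L ^ (M - 1) \<le> M" using \<open>M \<ge> 2\<close> by (intro dvd_imp_le) auto
  moreover have "3 ^ (M - 1) \<le> L ^ (M - 1)" using \<open>L \<ge> 3\<close> by (intro power_mono) auto
  moreover have "M < 3 ^ (M - 1)" using \<open>M \<ge> 2\<close>
  proof (induction M rule: nat_induct_at_least)
    case (Suc n)
    hence "(3 :: nat) ^ (Suc n - 1) = 3 * 3 ^ (n - 1)" by (cases n) auto
    thus ?case using Suc by linarith
  qed simp
  ultimately show False by linarith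
qed

subsection \<open>Traces of matrices of finite order\<close>

definition mat_trace :: "'a :: comm_monoid_add mat \<Rightarrow> 'a" where
  "mat_trace A = (\<Sum>i<dim_row A. A $$ (i, i))"

lemma mat_trace_comm:
  fixes A B :: "'a :: comm_semiring_0 mat"
  assumes "A \<in> carrier_mat n m" "B \<in> carrier_mat m n"
  shows "mat_trace (A * B) = mat_trace (B * A)"
proof -
  have "mat_trace (A * B) = (\<Sum>i<n. \<Sum>j<m. A $$ (i, j) * B $$ (j, i))"
    using assms by (auto simp: mat_trace_def scalar_prod_def atLeast0LessThan)
  also have "\<dots> = (\<Sum>j<m. \<Sum>i<n. B $$ (j, i) * A $$ (i, j))"
    by (subst sum.swap) (simp add: mult.commute)
  also have "\<dots> = mat_trace (B * A)"
    using assms by (auto simp: mat_trace_def scalar_prod_def atLeast0LessThan)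
  finally show ?thesis .
qed

text \<open>The trace is the sum of the eigenvalues, and each eigenvalue of a matrix whose
  \<open>n\<close>-th power is the identity is an \<open>n\<close>-th root of unity.\<close>

lemma trace_finite_order:
  fixes A :: "complex mat"
  assumes A: "A \<in> carrier_mat d d" and fin: "A ^\<^sub>m n = 1\<^sub>m d"
  shows "mat_trace A \<in> cyclotomic_integers n"
proof -
  obtain as where as: "char_poly A = (\<Prod>a\<leftarrow>as. [:- a, 1:])"
    using char_poly_factorized[OF A] by blast
  obtain B P Q where "schur_decomposition A as = (B, P, Q)" by (metis prod_cases3)
  from schur_decomposition[OF A as this]
  have sim: "similar_mat_wit A B P Q" and diag: "diag_mat B = as" by auto
  note s = similar_mat_witD2[OF A sim]
  \<comment> \<open>Cyclic invariance of the trace passes from \<open>A\<close> to its Schur form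
    \<open>B\<close>, whose diagonal is the list of eigenvalues.\<close>
  have "mat_trace A = mat_trace (P * (B * Q))" using s by (simp add: assoc_mult_mat[of P d d B d Q d])
  also have "\<dots> = mat_trace (B * Q * P)" using s by (intro mat_trace_comm[of _ d d]) auto
  also have "B * Q * P = B" using s by (simp add: assoc_mult_mat[of B d d Q d P d])
  also have "mat_trace B = sum_list as"
    by (simp add: diag[symmetric] mat_trace_def diag_mat_def interv_sum_list_conv_sum_set_nat atLeast0LessThan)
  also have "\<dots> \<in> cyclotomic_integers n"
  proof (intro cyclotomic_integers_sum_list cyclotomic_integers.root)
    fix a assume "a \<in> set as"
    hence "poly (char_poly A) a = 0" by (auto simp: as poly_prod_list prod_list_zero_iff)
    then obtain v where v: "eigenvector A v a"
      using eigenvalue_root_char_poly[OF A] unfolding eigenvalue_def by blast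
    hence vc: "v \<in> carrier_vec d" "v \<noteq> 0\<^sub>v d" using A by (auto simp: eigenvector_def)
    have "v = a ^ n \<cdot>\<^sub>v v" using eigenvector_pow[OF A v, of n] fin vc by simp
    moreover obtain i where "i < d" "v $ i \<noteq> 0" using vc by (metis carrier_vecD eq_vecI index_zero_vec)
    ultimately show "a ^ n = 1" using vc
      by (metis carrier_vecD index_smult_vec(1) mult_cancel_right1)
  qed
  finally show ?thesis .
qed

subsection \<open>The walk in momentum space\<close>

lemma finsum_mat:
  fixes f :: "'b \<Rightarrow> 'a :: comm_ring_1 mat"
  assumes "finite S" "\<And>k. k \<in> S \<Longrightarrow> f k \<in> carrier_mat nr nc"
  shows "finsum (module_mat TYPE('a) nr nc) f S = mat nr nc (\<lambda>ij. \<Sum>k\<in>S. f k $$ ij)"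
proof -
  interpret M: abelian_group "module_mat TYPE('a) nr nc" by (rule abelian_group_mat)
  show ?thesis
    using assms
  proof (induction S)
    case empty
    show ?case by (auto simp: module_mat_simps)
  next
    case (insert k S)
    hence "finsum (module_mat TYPE('a) nr nc) f (insert k S) = f k + finsum (module_mat TYPE('a) nr nc) f S"
      using M.finsum_insert[of S k f] by (auto simp: module_mat_simps)
    also have "\<dots> = mat nr nc (\<lambda>ij. \<Sum>k\<in>insert k S. f k $$ ij)"
      using insert.IH insert.prems insert.hyps by (intro eq_matI) auto
    finally show ?case .
  qed
qed

lemma tensor_index_less: "k < N \<Longrightarrow> i < L \<Longrightarrow> k * L + i < N * (L :: nat)"
  by (metis add.commute add_less_cancel_left less_le_trans mult_Suc mult_le_mono1 Suc_leI)

lemma coin_op_F_eq: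
  "coin_op_F L N = mat (N * L) (N * L)
     (\<lambda>(a, b). if a div L = b div L then local_coin_F L $$ (a mod L, b mod L) else 0)"
proof -
  have "coin_op_F L N = mat (N * L) (N * L)
      (\<lambda>ij. \<Sum>k\<in>{0..<N}. tensor_mat (proj_pos N k) (local_coin_F L) $$ ij)"
    unfolding coin_op_F_def
    by (intro finsum_mat) (auto simp: tensor_mat_def proj_pos_def local_coin_F_def)
  also have "\<dots> = mat (N * L) (N * L)
     (\<lambda>(a, b). if a div L = b div L then local_coin_F L $$ (a mod L, b mod L) else 0)"
  proof (intro eq_matI; clarsimp)
    fix a b assume ab: "a < N * L" "b < N * L"
    hence d: "a div L < N" "b div L < N" by (simp_all add: less_mult_imp_div_less)
    \<comment> \<open>The projection at \<open>k\<close> is nonzero only where both positions equal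
      \<open>k\<close>, so at most one summand survives.\<close>
    have "(\<Sum>k = 0..<N. tensor_mat (proj_pos N k) (local_coin_F L) $$ (a, b)) =
        (\<Sum>k = 0..<N. if k = a div L then (if a div L = b div L then local_coin_F L $$ (a mod L, b mod L) else 0) else 0)"
      using ab d by (intro sum.cong) (auto simp: tensor_mat_def proj_pos_def local_coin_F_def unit_vec_def)
    thus "(a div L = b div L \<longrightarrow> (\<Sum>k = 0..<N. tensor_mat (proj_pos N k) (local_coin_F L) $$ (a, b)) =
        local_coin_F L $$ (a mod L, b mod L)) \<and>
      (a div L \<noteq> b div L \<longrightarrow> (\<Sum>k = 0..<N. tensor_mat (proj_pos N k) (local_coin_F L) $$ (a, b)) = 0)"
      using d by simp
  qed
  finally show ?thesis .
qed

lemma walk_F_carrier: "walk_F L N \<in> carrier_mat (N * L) (N * L)"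
  unfolding walk_F_def by (rule mult_carrier_mat[of _ _ "N * L"]) (simp_all add: shift_op_def coin_op_F_eq)

text \<open>One frequency of the unnormalised discrete Fourier transform in the position, tensored
  with the identity on the coin; the full transform is the family over all \<open>z\<close> with
  \<open>z ^ N = 1\<close>.\<close>

definition fourier_mat :: "complex \<Rightarrow> nat \<Rightarrow> nat \<Rightarrow> complex mat" where
  "fourier_mat z L N = mat L (N * L) (\<lambda>(i, a). if a mod L = i then z ^ (a div L) else 0)"

text \<open>The factor by which the shift acts on coin state \<open>i\<close> at frequency
  \<open>z\<close>. Left movers have negative exponents, hence \<open>powi\<close>.\<close>

definition phase :: "complex \<Rightarrow> nat \<Rightarrow> nat \<Rightarrow> complex" where
  "phase z L i = z powi (int i - int (half L))"

definition momentum_walk :: "complex \<Rightarrow> nat \<Rightarrow> complex mat" where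
  "momentum_walk z L = mat L L (\<lambda>(i, j). phase z L i * local_coin_F L $$ (i, j))"

lemma fourier_mat_carrier: "fourier_mat z L N \<in> carrier_mat L (N * L)"
  by (simp add: fourier_mat_def)

lemma momentum_walk_carrier: "momentum_walk z L \<in> carrier_mat L L"
  by (simp add: momentum_walk_def)

lemma fourier_mat_mult_index:
  assumes X: "X \<in> carrier_mat (N * L) nc" and ib: "i < L" "b < nc"
  shows "(fourier_mat z L N * X) $$ (i, b) = (\<Sum>k<N. z ^ k * X $$ (k * L + i, b))"
proof -
  have "(fourier_mat z L N * X) $$ (i, b) =
      (\<Sum>a<N * L. (if a mod L = i then z ^ (a div L) else 0) * X $$ (a, b))"
    using assms by (simp add: fourier_mat_def scalar_prod_def atLeast0LessThan)
  also have "\<dots> = (\<Sum>a\<in>(\<lambda>k. k * L + i) ` {..<N}. z ^ (a div L) * X $$ (a, b))"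
  proof (intro sum.mono_neutral_cong_right ballI)
    fix a assume a: "a \<in> {..<N * L} - (\<lambda>k. k * L + i) ` {..<N}"
    have "a mod L \<noteq> i"
    proof
      assume "a mod L = i"
      hence "a = (a div L) * L + i" by (metis div_mult_mod_eq)
      moreover have "a div L < N" using a by (simp add: less_mult_imp_div_less)
      ultimately show False using a by blast
    qed
    thus "(if a mod L = i then z ^ (a div L) else 0) * X $$ (a, b) = 0" by simp
  qed (use ib in \<open>auto simp: tensor_index_less\<close>)
  also have "\<dots> = (\<Sum>k<N. z ^ k * X $$ (k * L + i, b))"
    using ib by (subst sum.reindex) (auto intro!: inj_onI)
  finally show ?thesis .
qed

text \<open>For a fixed coin index and column, the entries of \<open>X - Y\<close> are the
  coefficients of a polynomial of degree below \<open>N\<close> that vanishes at all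
  \<open>N\<close>-th roots of unity. This transfers identities from the frequencies back to the
  walk.\<close>

lemma fourier_mat_inject:
  assumes "N > 0" and XY: "X \<in> carrier_mat (N * L) nc" "Y \<in> carrier_mat (N * L) nc"
    and eq: "\<And>z. z ^ N = 1 \<Longrightarrow> fourier_mat z L N * X = fourier_mat z L N * Y"
  shows "X = Y"
proof (rule eq_matI)
  fix a b assume "a < dim_row Y" "b < dim_col Y"
  hence ab: "a < N * L" "b < nc" using XY by auto
  hence "L > 0" by (cases L) auto
  define i where "i = a mod L"
  define k where "k = a div L"
  have ik: "i < L" "k < N" "a = k * L + i"
    using ab \<open>L > 0\<close> by (simp_all add: i_def k_def less_mult_imp_div_less)
  define p where "p = (\<Sum>k<N. monom (X $$ (k * L + i, b) - Y $$ (k * L + i, b)) k)"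
  have "p = 0"
  proof (rule poly_eqI_degree)
    fix z :: complex assume "z \<in> {z. z ^ N = 1}"
    hence "(fourier_mat z L N * X) $$ (i, b) = (fourier_mat z L N * Y) $$ (i, b)" using eq by simp
    thus "poly p z = poly 0 z"
      using fourier_mat_mult_index[OF XY(1) ik(1) ab(2)] fourier_mat_mult_index[OF XY(2) ik(1) ab(2)]
      by (simp add: p_def poly_sum poly_monom algebra_simps sum_subtractf)
  next
    have "degree p \<le> N - 1" unfolding p_def
      by (intro degree_sum_le) (auto intro: order.trans[OF degree_monom_le])
    thus "degree p < card {z :: complex. z ^ N = 1}"
      using \<open>N > 0\<close> by (simp add: card_roots_unity_eq)
  qed (use \<open>N > 0\<close> in \<open>simp add: card_roots_unity_eq\<close>)
  hence "coeff p k = 0" by simp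
  moreover have "coeff p k = X $$ (k * L + i, b) - Y $$ (k * L + i, b)"
    using ik by (simp add: p_def coeff_sum)
  ultimately show "X $$ (a, b) = Y $$ (a, b)" using ik by simp
qed (use XY in auto)

text \<open>Wrapping around the cycle changes the exponent by a multiple of \<open>N\<close>, which
  \<open>z\<close> does not see.\<close>

lemma power_nat_mod_root_of_unity:
  assumes "z ^ N = (1 :: complex)" "N > 0"
  shows "z ^ nat (k mod int N) = z powi k"
proof -
  have z: "z \<noteq> 0" using assms by (auto simp: power_0_left)
  have "z powi k = z powi (int N * (k div int N)) * z powi (k mod int N)"
    using z by (simp add: power_int_add[symmetric])
  also have "z powi (int N * (k div int N)) = 1"
    using assms by (simp add: power_int_mult)
  also have "z powi (k mod int N) = z ^ nat (k mod int N)"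
    using assms by (simp add: power_int_def)
  finally show ?thesis by simp
qed

text \<open>A translation by \<open>d\<close> becomes multiplication by \<open>z powi d\<close>, so
  the shift turns into a diagonal matrix of phases.\<close>

lemma fourier_shift:
  assumes "z ^ N = 1" "N > 0"
  shows "fourier_mat z L N * shift_op L N = mat L L (\<lambda>(i, j). if i = j then phase z L i else 0) * fourier_mat z L N"
    (is "_ = ?D * _")
proof (rule eq_matI)
  fix i b assume "i < dim_row (?D * fourier_mat z L N)" "b < dim_col (?D * fourier_mat z L N)"
  hence ib: "i < L" "b < N * L" by (simp_all add: fourier_mat_def)
  define d where "d = int (b div L) + (int (b mod L) - int (half L))"
  have z: "z \<noteq> 0" using assms by (auto simp: power_0_left)
  have S: "shift_op L N \<in> carrier_mat (N * L) (N * L)" by (simp add: shift_op_def)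
  have "nat (d mod int N) < N" using assms by (simp add: nat_less_iff)
  have "(fourier_mat z L N * shift_op L N) $$ (i, b) = (\<Sum>k<N. z ^ k * shift_op L N $$ (k * L + i, b))"
    using S ib by (rule fourier_mat_mult_index)
  \<comment> \<open>Column \<open>b\<close> of the shift has its only nonzero entry at position
    \<open>d\<close> modulo \<open>N\<close>, with the coin index unchanged.\<close>
  also have "\<dots> = (\<Sum>k<N. if k = nat (d mod int N) then (if b mod L = i then z ^ k else 0) else 0)"
    using ib \<open>N > 0\<close>
    by (intro sum.cong) (auto simp: shift_op_def tensor_index_less d_def)
  also have "\<dots> = (if b mod L = i then z ^ nat (d mod int N) else 0)"
    using \<open>nat (d mod int N) < N\<close> by simp
  also have "\<dots> = (if b mod L = i then phase z L i * z ^ (b div L) else 0)"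
    using z by (simp add: power_nat_mod_root_of_unity[OF assms] d_def phase_def power_int_add)
  also have "\<dots> = (\<Sum>j<L. (if i = j then phase z L i else 0) * (if b mod L = j then z ^ (b div L) else 0))"
    using ib by (simp add: if_distrib[of "\<lambda>x. x * _"] cong: if_cong)
  also have "\<dots> = (?D * fourier_mat z L N) $$ (i, b)"
    using ib by (simp add: fourier_mat_def scalar_prod_def atLeast0LessThan)
  finally show "(fourier_mat z L N * shift_op L N) $$ (i, b) = (?D * fourier_mat z L N) $$ (i, b)" .
qed (simp_all add: fourier_mat_def shift_op_def)

text \<open>The coin acts in the same way at every position, so no condition on \<open>z\<close>
  arises.\<close>

lemma fourier_coin:
  "fourier_mat z L N * coin_op_F L N = local_coin_F L * fourier_mat z L N"
proof (rule eq_matI)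
  fix i b assume "i < dim_row (local_coin_F L * fourier_mat z L N)"
    "b < dim_col (local_coin_F L * fourier_mat z L N)"
  hence ib: "i < L" "b < N * L" by (simp_all add: fourier_mat_def local_coin_F_def)
  hence bd: "b div L < N" "b mod L < L" by (simp_all add: less_mult_imp_div_less)
  have C: "coin_op_F L N \<in> carrier_mat (N * L) (N * L)" by (simp add: coin_op_F_eq)
  have "(fourier_mat z L N * coin_op_F L N) $$ (i, b) = (\<Sum>k<N. z ^ k * coin_op_F L N $$ (k * L + i, b))"
    using C ib by (rule fourier_mat_mult_index)
  also have "\<dots> = (\<Sum>k<N. if k = b div L then z ^ k * local_coin_F L $$ (i, b mod L) else 0)"
    using ib by (intro sum.cong) (auto simp: coin_op_F_eq tensor_index_less)
  also have "\<dots> = z ^ (b div L) * local_coin_F L $$ (i, b mod L)"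
    using bd by simp
  also have "\<dots> = (\<Sum>j<L. local_coin_F L $$ (i, j) * (if b mod L = j then z ^ (b div L) else 0))"
    using bd by (simp add: if_distrib[of "\<lambda>x. _ * x"] mult.commute cong: if_cong)
  also have "\<dots> = (local_coin_F L * fourier_mat z L N) $$ (i, b)"
    using ib by (simp add: fourier_mat_def local_coin_F_def scalar_prod_def atLeast0LessThan)
  finally show "(fourier_mat z L N * coin_op_F L N) $$ (i, b) = (local_coin_F L * fourier_mat z L N) $$ (i, b)" .
qed (simp_all add: fourier_mat_def local_coin_F_def coin_op_F_eq)

lemma fourier_walk:
  assumes "z ^ N = 1" "N > 0"
  shows "fourier_mat z L N * walk_F L N = momentum_walk z L * fourier_mat z L N"
proof -
  let ?F = "fourier_mat z L N"
  define D where "D = mat L L (\<lambda>(i, j). if i = j then phase z L i else 0)"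
  have c: "?F \<in> carrier_mat L (N * L)" "shift_op L N \<in> carrier_mat (N * L) (N * L)"
    "coin_op_F L N \<in> carrier_mat (N * L) (N * L)" "local_coin_F L \<in> carrier_mat L L" "D \<in> carrier_mat L L"
    by (simp_all add: fourier_mat_def shift_op_def coin_op_F_eq local_coin_F_def D_def)
  have "?F * walk_F L N = ?F * shift_op L N * coin_op_F L N"
    unfolding walk_F_def using c by (simp add: assoc_mult_mat[of _ L "N * L" _ "N * L" _ "N * L"])
  also have "\<dots> = D * (?F * coin_op_F L N)"
    unfolding fourier_shift[OF assms] D_def[symmetric]
    using c by (intro assoc_mult_mat) auto
  also have "\<dots> = D * local_coin_F L * ?F"
    unfolding fourier_coin using c by (simp add: assoc_mult_mat[of _ L L _ L _ "N * L"])
  also have "D * local_coin_F L = momentum_walk z L"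
  proof (rule eq_matI)
    fix i j assume "i < dim_row (momentum_walk z L)" "j < dim_col (momentum_walk z L)"
    hence "i < L" "j < L" by (simp_all add: momentum_walk_def)
    hence "(D * local_coin_F L) $$ (i, j) = (\<Sum>k<L. (if i = k then phase z L i else 0) * local_coin_F L $$ (k, j))"
      by (simp add: D_def local_coin_F_def scalar_prod_def atLeast0LessThan)
    thus "(D * local_coin_F L) $$ (i, j) = momentum_walk z L $$ (i, j)"
      using \<open>i < L\<close> \<open>j < L\<close>
      by (simp add: momentum_walk_def if_distrib[of "\<lambda>x. x * _"] cong: if_cong)
  qed (simp_all add: D_def local_coin_F_def momentum_walk_def)
  finally show ?thesis .
qed

lemma fourier_walk_power:
  assumes "z ^ N = 1" "N > 0"
  shows "fourier_mat z L N * walk_F L N ^\<^sub>m n = momentum_walk z L ^\<^sub>m n * fourier_mat z L N"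
proof (induction n)
  case 0
  show ?case using fourier_mat_carrier[of z L N] walk_F_carrier[of L N] momentum_walk_carrier[of z L] by simp
next
  case (Suc n)
  let ?F = "fourier_mat z L N" and ?U = "walk_F L N" and ?V = "momentum_walk z L"
  note c = fourier_mat_carrier[of z L N] walk_F_carrier[of L N] momentum_walk_carrier[of z L]
  note p = pow_carrier_mat[OF c(2), of n] pow_carrier_mat[OF c(3), of n]
  have "?F * ?U ^\<^sub>m Suc n = ?F * ?U ^\<^sub>m n * ?U"
    using assoc_mult_mat[OF c(1) p(1) c(2)] by simp
  also have "\<dots> = ?V ^\<^sub>m n * (?F * ?U)"
    unfolding Suc.IH by (rule assoc_mult_mat[OF p(2) c(1) c(2)])
  also have "\<dots> = ?V ^\<^sub>m Suc n * ?F"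
    unfolding fourier_walk[OF assms] using assoc_mult_mat[OF p(2) c(3) c(1)] by simp
  finally show ?case .
qed

text \<open>Intertwining turns the hypothesis into \<open>V ^ n * F = F\<close>, and
  \<open>F\<close> can be cancelled because it has a right inverse.\<close>

lemma momentum_walk_power_eq_1:
  assumes z: "z ^ N = 1" "N > 0" and U: "walk_F L N ^\<^sub>m n = 1\<^sub>m (N * L)"
  shows "momentum_walk z L ^\<^sub>m n = 1\<^sub>m L"
proof -
  let ?F = "fourier_mat z L N" and ?V = "momentum_walk z L"
  \<comment> \<open>The embedding of the coin space at position 0, where the Fourier weight is
    \<open>z ^ 0 = 1\<close>.\<close>
  define E :: "complex mat" where "E = mat (N * L) L (\<lambda>(a, i). if a = i then 1 else 0)"
  have E: "E \<in> carrier_mat (N * L) L" by (simp add: E_def)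
  note c = fourier_mat_carrier[of z L N] momentum_walk_carrier[of z L]
  note p = pow_carrier_mat[OF c(2), of n]
  have FE: "?F * E = 1\<^sub>m L"
  proof (rule eq_matI)
    fix i j assume "i < dim_row (1\<^sub>m L :: complex mat)" "j < dim_col (1\<^sub>m L :: complex mat)"
    hence ij: "i < L" "j < L" by simp_all
    have "(?F * E) $$ (i, j) = (\<Sum>k<N. z ^ k * E $$ (k * L + i, j))"
      using E ij by (rule fourier_mat_mult_index)
    also have "\<dots> = (\<Sum>k<N. if k = 0 then if i = j then 1 else 0 else 0)"
    proof (intro sum.cong refl)
      fix k assume "k \<in> {..<N}"
      moreover have "k * L + i = j \<longleftrightarrow> k = 0 \<and> i = j" using ij by (cases k) auto
      ultimately show "z ^ k * E $$ (k * L + i, j) = (if k = 0 then if i = j then 1 else 0 else 0)"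
        using ij by (auto simp: E_def tensor_index_less)
    qed
    finally show "(?F * E) $$ (i, j) = 1\<^sub>m L $$ (i, j)" using ij z by simp
  qed (simp_all add: E_def fourier_mat_def)
  have "?V ^\<^sub>m n = ?V ^\<^sub>m n * (?F * E)" using right_mult_one_mat[OF p] by (simp add: FE)
  also have "\<dots> = ?V ^\<^sub>m n * ?F * E" by (rule assoc_mult_mat[OF p c(1) E, symmetric])
  also have "?V ^\<^sub>m n * ?F = ?F" using fourier_walk_power[OF z, of L n] c by (simp add: U)
  finally show ?thesis by (simp add: FE)
qed

subsection \<open>Traces and powers in momentum space\<close>

text \<open>Since \<open>L = 2 * m + 1\<close>, the antidiagonal entry is \<open>2 / L - 1\<close>.
  Thus the coin is a rank-one matrix minus the reversal of the coin basis, which makes traces and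
  squares computable.\<close>

lemma local_coin_F_index:
  assumes "odd L" "i < L" "j < L"
  shows "local_coin_F L $$ (i, j) = 2 / of_nat L - of_bool (i = 2 * half L - j)"
proof -
  have L: "L = 2 * half L + 1" using assms by (simp add: half_def)
  hence "(of_nat L :: complex) = 2 * of_nat (half L) + 1" by (metis of_nat_1 of_nat_add of_nat_mult of_nat_numeral)
  moreover have "(of_nat L :: complex) \<noteq> 0" using assms by auto
  ultimately have "- (2 * of_nat (half L) - 1) / of_nat L = (2 / of_nat L - 1 :: complex)"
    by (simp add: divide_simps)
  moreover have "i + j = L - 1 \<longleftrightarrow> i = 2 * half L - j" using assms L by auto
  ultimately show ?thesis using assms by (auto simp: local_coin_F_def)
qed

lemma phase_mirror:
  assumes "odd L" "i < L" "z \<noteq> 0"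
  shows "phase z L i * phase z L (2 * half L - i) = 1"
proof -
  have "i \<le> 2 * half L" using assms by (simp add: half_def)
  thus ?thesis using assms by (simp add: phase_def power_int_add[symmetric] of_nat_diff)
qed

text \<open>A geometric series, shifted by \<open>z ^ m\<close>. The form without division also
  covers \<open>z = 1\<close>.\<close>

lemma sum_phase:
  assumes "z \<noteq> 0"
  shows "(\<Sum>i<L. phase z L i) * z ^ half L * (1 - z) = 1 - z ^ L"
proof -
  have "phase z L i * z ^ half L = z ^ i" for i
    using assms by (simp add: phase_def power_int_diff)
  hence "(\<Sum>i<L. phase z L i) * z ^ half L = (\<Sum>i<L. z ^ i)"
    by (simp add: sum_distrib_right)
  thus ?thesis by (simp add: one_diff_power_eq mult.commute)
qed

text \<open>Only the resting state lies on both diagonals; its phase is 1, so the reversal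
  contributes -1 to the trace.\<close>

lemma momentum_walk_trace:
  assumes "odd L" "z \<noteq> 0"
  shows "(mat_trace (momentum_walk z L) + 1) * z ^ half L * (1 - z) = 2 * (1 - z ^ L) / of_nat L"
proof -
  have m: "half L < L" using assms by (auto simp: half_def elim!: oddE)
  have "mat_trace (momentum_walk z L) =
      (\<Sum>i<L. 2 / of_nat L * phase z L i - (if i = half L then phase z L i else 0))"
    unfolding mat_trace_def using assms(1)
    by (intro sum.cong) (auto simp: momentum_walk_def local_coin_F_index algebra_simps)
  also have "\<dots> = 2 / of_nat L * (\<Sum>i<L. phase z L i) - 1"
    using m by (simp add: sum_subtractf sum_distrib_left phase_def)
  finally have "(mat_trace (momentum_walk z L) + 1) * z ^ half L * (1 - z) =
      2 / of_nat L * ((\<Sum>i<L. phase z L i) * z ^ half L * (1 - z))" by simp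
  thus ?thesis unfolding sum_phase[OF assms(2)] by simp
qed

section \<open>Infinite order for \<open>N\<close> different from \<open>L\<close>\<close>

text \<open>The trace is a combination of \<open>n\<close>-th roots of unity and \<open>z\<close> is
  an \<open>N\<close>-th root; the order \<open>n * N\<close> accommodates both.\<close>

lemma walk_F_power_imp_cyclotomic:
  assumes "odd L" "N > 0" "walk_F L N ^\<^sub>m n = 1\<^sub>m (N * L)" "z ^ N = 1"
  shows "2 * (1 - z ^ L) / of_nat L \<in> cyclotomic_integers (n * N)"
proof -
  have z: "z \<noteq> 0" using assms by (auto simp: power_0_left)
  have "mat_trace (momentum_walk z L) \<in> cyclotomic_integers n"
    using momentum_walk_carrier momentum_walk_power_eq_1[OF assms(4,2,3)] by (rule trace_finite_order)
  hence "mat_trace (momentum_walk z L) \<in> cyclotomic_integers (n * N)"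
    by (rule cyclotomic_integers_mono) simp
  moreover have "w ^ N = 1 \<Longrightarrow> w \<in> cyclotomic_integers (n * N)" for w
    by (rule cyclotomic_integers_mono[OF cyclotomic_integers.root[of w N]]) auto
  moreover have "(z ^ half L) ^ N = 1"
    using assms(4) by (metis mult.commute power_mult power_one)
  ultimately have "(mat_trace (momentum_walk z L) + 1) * z ^ half L * (1 - z) \<in> cyclotomic_integers (n * N)"
    using assms(4)
    by (intro cyclotomic_integers_mult cyclotomic_integers_add cyclotomic_integers.diff) auto
  thus ?thesis using momentum_walk_trace[OF assms(1) z] by simp
qed

lemma surj_power_roots_of_unity:
  fixes w :: complex
  assumes "prime L" "N > 0" "w ^ (N div gcd N L) = 1"
  shows "\<exists>z. z ^ N = 1 \<and> z ^ L = w"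
proof (cases "L dvd N")
  case True
  have "L > 0" using assms(1) prime_gt_0_nat by simp
  obtain M where N: "N = L * M" using True by blast
  have "w ^ M = 1" using assms(3) \<open>L > 0\<close> by (simp add: N)
  have "w \<noteq> 0" using \<open>w ^ M = 1\<close> assms(2) by (auto simp: N power_0_left)
  hence "card {z. z ^ L = w} > 0" using \<open>L > 0\<close> by (simp add: card_nth_roots)
  then obtain z where "z ^ L = w" by (auto simp: card_gt_0_iff)
  thus ?thesis using \<open>w ^ M = 1\<close> by (auto simp: N power_mult)
next
  case False
  hence "coprime L N" using assms(1) by (simp add: prime_imp_coprime)
  hence g: "gcd N L = 1" by (simp add: coprime_iff_gcd_eq_1 gcd.commute)
  hence w: "w ^ N = 1" using assms(3) by simp
  have "L \<noteq> 0" using assms(1) by auto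
  \<comment> \<open>The exponent \<open>x\<close> inverts \<open>L\<close> modulo \<open>N\<close>,
    so \<open>w ^ x\<close> is the required \<open>L\<close>-th root.\<close>
  obtain x y where "L * x = N * y + 1"
    using bezout_nat[OF \<open>L \<noteq> 0\<close>, of N] g by (auto simp: gcd.commute)
  hence "w ^ (L * x) = w ^ (N * y) * w" by (simp only: power_add power_one_right)
  also have "w ^ (N * y) = 1" by (simp add: w power_mult)
  also have "w ^ (L * x) = (w ^ x) ^ L" by (subst mult.commute) (rule power_mult)
  finally have "(w ^ x) ^ L = w" by simp
  moreover have "(w ^ x) ^ N = 1" using w by (metis mult.commute power_mult power_one)
  ultimately show ?thesis by blast
qed

lemma walk_F_infinite_order:
  assumes "prime L" "L \<ge> 3" "N \<ge> 2" "N \<noteq> L" "n \<ge> 1"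
  shows "walk_F L N ^\<^sub>m n \<noteq> 1\<^sub>m (N * L)"
proof
  assume U: "walk_F L N ^\<^sub>m n = 1\<^sub>m (N * L)"
  have "odd L" using assms(1,2) by (simp add: prime_odd_nat)
  define M where "M = N div gcd N L"
  have NM: "N = M * gcd N L" by (simp add: M_def)
  have "gcd N L = 1 \<or> gcd N L = L" using assms(1) by (metis gcd_dvd2 prime_nat_iff)
  \<comment> \<open>Otherwise \<open>N = gcd N L\<close> would be 1 or \<open>L\<close>.\<close>
  hence "M \<noteq> 1" using NM assms(3,4) by (metis mult_1 numeral_le_one_iff semiring_norm(69))
  moreover have "M \<noteq> 0" using NM assms(3) by (metis mult_0 not_numeral_le_zero)
  ultimately have "M \<ge> 2" by linarith
  moreover have "2 * (1 - w) / of_nat L \<in> cyclotomic_integers (n * N)" if "w ^ M = 1" for w :: complex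
  proof -
    have "N > 0" using assms(3) by simp
    from surj_power_roots_of_unity[OF assms(1) this that[unfolded M_def]]
    obtain z where "z ^ N = 1" "z ^ L = w" by blast
    thus ?thesis using walk_F_power_imp_cyclotomic[OF \<open>odd L\<close> \<open>N > 0\<close> U, of z] by simp
  qed
  ultimately show False
    using not_all_cyclotomic_integers[OF \<open>odd L\<close> assms(2), of M "n * N"] assms(3,5) by simp
qed

section \<open>Order four for \<open>N = L\<close>\<close>

text \<open>An entry of \<open>(1 - F) * (1 - G)\<close>, where \<open>f\<close> is row
  \<open>i\<close> of \<open>F\<close> and \<open>g\<close> is column \<open>l\<close> of
  \<open>G\<close>; it serves for both the square and the fourth power.\<close>

lemma sum_delta_diff_mult:
  fixes f g :: "nat \<Rightarrow> complex"
  assumes "i < L" "l < L"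
  shows "(\<Sum>j<L. (of_bool (i = j) - f j) * (of_bool (j = l) - g j)) =
    of_bool (i = l) - g i - f l + (\<Sum>j<L. f j * g j)"
proof -
  have "(\<Sum>j<L. (of_bool (i = j) - f j) * (of_bool (j = l) - g j)) =
      (\<Sum>j<L. (if j = i then of_bool (i = l) - g i else 0) - (if j = l then f l else 0) + f j * g j)"
    by (intro sum.cong) (auto simp: algebra_simps)
  thus ?thesis using assms by (simp add: sum.distrib sum_subtractf)
qed

text \<open>Write \<open>V = D * (c * J - R)\<close> with the phases \<open>D\<close>, the all-ones
  matrix \<open>J\<close> and the reversal \<open>R\<close>. By \<open>phase_mirror\<close>,
  \<open>D * R * D * R = 1\<close>, so the square is the identity plus three rank-one corrections
  coming from \<open>J\<close>.\<close>

lemma momentum_walk_square_index: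
  assumes "odd L" "z \<noteq> 0" "i < L" "l < L"
  shows "(momentum_walk z L ^\<^sub>m 2) $$ (i, l) = of_bool (i = l)
    - 2 / of_nat L * (1 + phase z L i * phase z L (2 * half L - l))
    + (2 / of_nat L)\<^sup>2 * (\<Sum>j<L. phase z L j) * phase z L i"
proof -
  define c :: complex where "c = 2 / of_nat L"
  define x where "x = phase z L"
  define r where "r k = 2 * half L - k" for k
  have L: "L = 2 * half L + 1" using assms(1) by (simp add: half_def)
  have r: "r k < L" for k using L by (simp add: r_def)
  have x: "x k * x (r k) = 1" if "k < L" for k
    using phase_mirror[OF assms(1) that assms(2)] by (simp add: x_def r_def)
  have coin: "local_coin_F L $$ (a, b) = c - of_bool (a = r b)" if "a < L" "b < L" for a b
    using local_coin_F_index[OF assms(1) that] by (simp add: c_def r_def)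
  have rr: "a = r b \<longleftrightarrow> r a = b" if "a < L" "b < L" for a b
    using that L by (auto simp: r_def)
  have "(momentum_walk z L ^\<^sub>m 2) $$ (i, l) =
      (\<Sum>j<L. momentum_walk z L $$ (i, j) * momentum_walk z L $$ (j, l))"
    using assms by (simp add: numeral_2_eq_2 momentum_walk_def scalar_prod_def atLeast0LessThan)
  \<comment> \<open>Pulling out \<open>x i * x (r l)\<close> leaves two factors of the form delta
    minus a remainder, as \<open>sum_delta_diff_mult\<close> needs. The relation
    \<open>x l * x (r l) = 1\<close> compensates for the phase of \<open>j\<close>.\<close>
  also have "\<dots> = (\<Sum>j<L. x i * x (r l) * ((of_bool (r i = j) - c) * (of_bool (j = r l) - c * x j * x l)))"
  proof (intro sum.cong refl)
    fix j assume "j \<in> {..<L}"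
    hence j: "j < L" by simp
    have P: "x j * (of_bool (j = r l) - c) = x (r l) * (of_bool (j = r l) - c * x j * x l)"
      using x[OF assms(4)] by (cases "j = r l") (auto simp: algebra_simps)
    have V: "momentum_walk z L $$ (i, j) = - x i * (of_bool (r i = j) - c)"
      using assms j by (simp add: momentum_walk_def coin x_def rr algebra_simps)
    have V': "momentum_walk z L $$ (j, l) = - x j * (of_bool (j = r l) - c)"
      using assms j by (simp add: momentum_walk_def coin x_def algebra_simps)
    have "momentum_walk z L $$ (i, j) * momentum_walk z L $$ (j, l) =
        x i * (of_bool (r i = j) - c) * (x j * (of_bool (j = r l) - c))"
      unfolding V V' by simp
    thus "momentum_walk z L $$ (i, j) * momentum_walk z L $$ (j, l) =
        x i * x (r l) * ((of_bool (r i = j) - c) * (of_bool (j = r l) - c * x j * x l))"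
      unfolding P by (simp only: mult_ac)
  qed
  also have "\<dots> = x i * x (r l) * (of_bool (r i = r l) - c * x (r i) * x l - c + (\<Sum>j<L. c * (c * x j * x l)))"
    using sum_delta_diff_mult[OF r[of i] r[of l], of "\<lambda>_. c" "\<lambda>j. c * x j * x l"]
    by (subst sum_distrib_left[symmetric]) (simp only:)
  also have "(\<Sum>j<L. c * (c * x j * x l)) = c\<^sup>2 * (\<Sum>j<L. x j) * x l"
    by (simp add: sum_distrib_left sum_distrib_right power2_eq_square mult_ac)
  also have "r i = r l \<longleftrightarrow> i = l" using L assms(3,4) by (auto simp: r_def)
  also have "x i * x (r l) * (of_bool (i = l) - c * x (r i) * x l - c + c\<^sup>2 * (\<Sum>j<L. x j) * x l) =
      x i * x (r l) * of_bool (i = l) - c * (x i * x (r i)) * (x l * x (r l)) - c * (x i * x (r l))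
      + c\<^sup>2 * (\<Sum>j<L. x j) * x i * (x l * x (r l))"
    by (simp add: algebra_simps)
  also have "\<dots> = of_bool (i = l) - c * (1 + x i * x (r l)) + c\<^sup>2 * (\<Sum>j<L. x j) * x i"
    using x[OF assms(3)] x[OF assms(4)] by (auto simp: algebra_simps)
  finally show ?thesis by (simp add: c_def x_def r_def)
qed

lemma sum_phase_eq_0:
  assumes "z ^ L = 1" "z \<noteq> 1" "L > 0"
  shows "(\<Sum>i<L. phase z L i) = 0"
proof -
  have "z \<noteq> 0" using assms by (auto simp: power_0_left)
  thus ?thesis using sum_phase[of z L] assms by simp
qed

lemma momentum_walk_power_4:
  assumes "odd L" "z ^ L = 1"
  shows "momentum_walk z L ^\<^sub>m 4 = 1\<^sub>m L"
proof -
  define c :: complex where "c = 2 / of_nat L"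
  define x where "x = phase z L"
  define r where "r k = 2 * half L - k" for k
  define W where "W = momentum_walk z L ^\<^sub>m 2"
  have "L > 0" using assms by (cases L) auto
  have z: "z \<noteq> 0" using assms \<open>L > 0\<close> by (auto simp: power_0_left)
  have L: "L = 2 * half L + 1" using assms(1) by (simp add: half_def)
  have cL: "c * of_nat L = 2" using \<open>L > 0\<close> by (simp add: c_def)
  have x: "x k * x (r k) = 1" if "k < L" for k
    using phase_mirror[OF assms(1) that z] by (simp add: x_def r_def)
  note V = momentum_walk_carrier[of z L]
  have W: "W \<in> carrier_mat L L" unfolding W_def using V by simp
  have WW: "momentum_walk z L ^\<^sub>m 4 = W * W"
    using V by (simp add: W_def numeral_eq_Suc assoc_mult_mat[of _ L L _ L _ L])
  note sq = momentum_walk_square_index[OF assms(1) z, folded W_def c_def x_def r_def]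
  have "W * W = 1\<^sub>m L"
  proof (rule eq_matI)
    fix i l assume "i < dim_row (1\<^sub>m L :: complex mat)" "l < dim_col (1\<^sub>m L :: complex mat)"
    hence il: "i < L" "l < L" by simp_all
    have "(W * W) $$ (i, l) = (\<Sum>j<L. W $$ (i, j) * W $$ (j, l))"
      using W il by (auto simp: scalar_prod_def atLeast0LessThan)
    also have "\<dots> = of_bool (i = l)"
    proof (cases "z = 1")
      case True
      \<comment> \<open>All phases are 1, so the corrections add up to
        \<open>- 2 * c + c * (c * L)\<close>, which vanishes because
        \<open>c * L = 2\<close>.\<close>
      hence "W $$ (i, l) = of_bool (i = l)" if "i < L" "l < L" for i l
        using sq[OF that] cL by (simp add: x_def phase_def power2_eq_square mult_ac)
      hence "(\<Sum>j<L. W $$ (i, j) * W $$ (j, l)) = (\<Sum>j<L. if j = i then of_bool (i = l) else 0)"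
        using il by (intro sum.cong) auto
      thus ?thesis using il by simp
    next
      case False
      have s: "(\<Sum>j<L. x j) = 0"
        using sum_phase_eq_0[OF assms(2) False \<open>L > 0\<close>] by (simp add: x_def)
      \<comment> \<open>Reversal only permutes the summands.\<close>
      have s': "(\<Sum>j<L. x (r j)) = 0"
        unfolding s[symmetric]
        by (rule sum.reindex_bij_witness[of _ r r]) (use L in \<open>auto simp: r_def\<close>)
      have sq': "W $$ (i, l) = of_bool (i = l) - c * (1 + x i * x (r l))" if "i < L" "l < L" for i l
        using sq[OF that] s by simp
      have "(\<Sum>j<L. W $$ (i, j) * W $$ (j, l)) =
          (\<Sum>j<L. (of_bool (i = j) - c * (1 + x i * x (r j))) * (of_bool (j = l) - c * (1 + x j * x (r l))))"
        using il by (intro sum.cong) (auto simp: sq')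
      also have "\<dots> = of_bool (i = l) - 2 * c * (1 + x i * x (r l))
          + (\<Sum>j<L. c * (1 + x i * x (r j)) * (c * (1 + x j * x (r l))))"
        by (subst sum_delta_diff_mult[OF il]) (simp add: algebra_simps)
      \<comment> \<open>Of the four products, two are independent of \<open>j\<close> because
        \<open>x j * x (r j) = 1\<close>; the other two are multiples of the vanishing phase sums.
        The surviving part cancels the linear correction because \<open>c * L = 2\<close>.\<close>
      also have "(\<Sum>j<L. c * (1 + x i * x (r j)) * (c * (1 + x j * x (r l)))) =
          (\<Sum>j<L. c\<^sup>2 * (1 + x i * x (r l)) + c\<^sup>2 * x (r l) * x j + c\<^sup>2 * x i * x (r j))"
      proof (intro sum.cong refl)
        fix j assume "j \<in> {..<L}"
        hence xj: "x j * x (r j) = 1" using x by simp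
        have "c * (1 + x i * x (r j)) * (c * (1 + x j * x (r l))) =
            c\<^sup>2 * (1 + x i * x (r l) * (x j * x (r j))) + c\<^sup>2 * x (r l) * x j + c\<^sup>2 * x i * x (r j)"
          by (simp add: algebra_simps power2_eq_square)
        thus "c * (1 + x i * x (r j)) * (c * (1 + x j * x (r l))) =
            c\<^sup>2 * (1 + x i * x (r l)) + c\<^sup>2 * x (r l) * x j + c\<^sup>2 * x i * x (r j)"
          by (simp only: xj mult_1_right)
      qed
      also have "\<dots> = of_nat L * (c\<^sup>2 * (1 + x i * x (r l))) + c\<^sup>2 * x (r l) * (\<Sum>j<L. x j)
          + c\<^sup>2 * x i * (\<Sum>j<L. x (r j))"
        by (simp only: sum.distrib sum_distrib_left sum_constant card_lessThan)
      also have "\<dots> = c * (c * of_nat L) * (1 + x i * x (r l))"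
        by (simp add: s s' power2_eq_square)
      finally show ?thesis unfolding cL by simp
    qed
    finally show "(W * W) $$ (i, l) = 1\<^sub>m L $$ (i, l)" using il by simp
  qed (use W in auto)
  thus ?thesis by (simp add: WW)
qed

lemma walk_F_power_4:
  assumes "odd L"
  shows "walk_F L L ^\<^sub>m 4 = 1\<^sub>m (L * L)"
proof (rule fourier_mat_inject)
  show "L > 0" using assms by (cases L) simp_all
  show "walk_F L L ^\<^sub>m 4 \<in> carrier_mat (L * L) (L * L)"
    using walk_F_carrier by (rule pow_carrier_mat)
  fix z :: complex assume z: "z ^ L = 1"
  show "fourier_mat z L L * walk_F L L ^\<^sub>m 4 = fourier_mat z L L * 1\<^sub>m (L * L)"
    unfolding fourier_walk_power[OF z \<open>L > 0\<close>] momentum_walk_power_4[OF assms z]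
      left_mult_one_mat[OF fourier_mat_carrier] right_mult_one_mat[OF fourier_mat_carrier] ..
qed (rule one_carrier_mat)

lemma walk_F_power_2:
  assumes "odd L" "L \<ge> 3"
  shows "walk_F L L ^\<^sub>m 2 \<noteq> 1\<^sub>m (L * L)"
proof
  assume U: "walk_F L L ^\<^sub>m 2 = 1\<^sub>m (L * L)"
  \<comment> \<open>At \<open>z = 1\<close> the square is the identity, so a nontrivial
    \<open>L\<close>-th root of unity is needed.\<close>
  have "card {z :: complex. z ^ L = 1} = L" using assms by (simp add: card_roots_unity_eq)
  hence "\<not> card {z :: complex. z ^ L = 1} \<le> card {1 :: complex}" using assms(2) by simp
  hence "\<not> {z :: complex. z ^ L = 1} \<subseteq> {1}" by (meson card_mono finite.emptyI finite.insertI)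
  then obtain z :: complex where z: "z ^ L = 1" "z \<noteq> 1" by blast
  have z0: "z \<noteq> 0" using z assms by (auto simp: power_0_left)
  have "L > 0" using assms by simp
  have "momentum_walk z L ^\<^sub>m 2 = 1\<^sub>m L" using momentum_walk_power_eq_1[OF z(1) \<open>L > 0\<close> U] .
  hence "1 = (momentum_walk z L ^\<^sub>m 2) $$ (0, 0)" using \<open>L > 0\<close> by simp
  \<comment> \<open>In the corner the mirrored phases multiply to 1 and the phase sum vanishes,
    which leaves \<open>1 - 2 / L * (1 + 1)\<close>.\<close>
  also have "\<dots> = 1 - 4 / of_nat L"
    unfolding momentum_walk_square_index[OF assms(1) z0 \<open>L > 0\<close> \<open>L > 0\<close>]
      phase_mirror[OF assms(1) \<open>L > 0\<close> z0] sum_phase_eq_0[OF z \<open>L > 0\<close>] by simp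
  finally show False using \<open>L > 0\<close> by simp
qed

section \<open>The period\<close>

theorem theorem4p9:
  fixes L N :: nat
  assumes "prime L" and "L \<ge> 3" and "N \<ge> 2"
  shows "period_F L N = (if N = L then 4 else \<infinity>)"
proof (cases "N = L")
  case False
  hence "{n. n \<ge> 1 \<and> walk_F L N ^\<^sub>m n = 1\<^sub>m (N * L)} = {}"
    using walk_F_infinite_order[OF assms] by auto
  hence "period_F L N = Inf (enat ` {})" unfolding period_F_def by (rule arg_cong)
  thus ?thesis using False by (simp add: top_enat_def)
next
  case True
  have "odd L" using assms by (simp add: prime_odd_nat)
  let ?U = "walk_F L L"
  note c = walk_F_carrier[of L L]
  note U2 = walk_F_power_2[OF \<open>odd L\<close> assms(2)] and U4 = walk_F_power_4[OF \<open>odd L\<close>]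
  \<comment> \<open>With fourth power 1, the exponents 1 and 3 reduce to the exponent 2: if the cube
    were 1, the fourth power would be \<open>?U\<close>, so \<open>?U\<close> would be 1 and its
    square too.\<close>
  have not_1: "?U \<noteq> 1\<^sub>m (L * L)"
  proof
    assume "?U = 1\<^sub>m (L * L)"
    hence "?U ^\<^sub>m 2 = 1\<^sub>m (L * L)" by (simp add: numeral_2_eq_2)
    thus False using U2 by contradiction
  qed
  have not_3: "?U ^\<^sub>m 3 \<noteq> 1\<^sub>m (L * L)"
  proof
    assume "?U ^\<^sub>m 3 = 1\<^sub>m (L * L)"
    hence "?U ^\<^sub>m Suc 3 = ?U" using left_mult_one_mat[OF c] by (simp only: pow_mat.simps)
    thus False using U4 not_1 by simp
  qed
  have ge: "4 \<le> n" if n: "n \<ge> 1" "?U ^\<^sub>m n = 1\<^sub>m (L * L)" for n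
  proof (rule ccontr)
    assume "\<not> 4 \<le> n"
    then consider "n = Suc 0" | "n = 2" | "n = 3" using n(1) by linarith
    thus False
    proof cases
      case 1
      hence "?U = 1\<^sub>m (L * L)" using n(2) c by simp
      thus False using not_1 by contradiction
    qed (use n(2) U2 not_3 in simp_all)
  qed
  have "Inf (enat ` {n. n \<ge> 1 \<and> ?U ^\<^sub>m n = 1\<^sub>m (L * L)}) = enat 4"
  proof (rule antisym)
    show "Inf (enat ` {n. n \<ge> 1 \<and> ?U ^\<^sub>m n = 1\<^sub>m (L * L)}) \<le> enat 4"
      using U4 by (intro Inf_lower) auto
    show "enat 4 \<le> Inf (enat ` {n. n \<ge> 1 \<and> ?U ^\<^sub>m n = 1\<^sub>m (L * L)})"
      using ge by (intro Inf_greatest) auto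
  qed
  thus ?thesis using True by (simp add: period_F_def numeral_eq_enat)
qed

end
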